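(* Let $b>0$ and let $\mu$ be a Borel measure on $(0,\infty)$ with $\bar\mu(x)<\infty$ for all $x>0$. Let $(M(t),t\ge0)$ be the standard $\mathrm{ESN}(b,\mu)$ process constructed from the Poisson point process $\mathcal{N}=\sum_{s\ge0}\delta_{(s,\xi_s)}$. The closure of its zero set satisfies $$\overline{\{t\ge0:M(t)=0\}}=[0,\infty)\setminus\bigcup_{s\ge0}(s,\,s+\xi_s/b)\quad\text{almost surely,}$$ where the union is over the atoms $(s,\xi_s)$ of $\mathcal{N}$.
   Context: Write $(a)_+=\max(a,0)$ and $\bar\mu(x):=\mu([x,\infty))$ for $x>0$. $\mathcal{N}=\sum_{s\ge0}\delta_{(s,\xi_s)}$ is a Poisson point process on $[0,\infty)\times(0,\infty)$ with intensity $\lambda\times\mu$, $\lambda$ being Lebesgue measure; set $\xi_s=0$ at times $s$ which carry no atom. The standard $\mathrm{ESN}(b,\mu)$ (extremal shot noise) process is $$M(t):=\sup_{0\le s\le t}\big(\xi_s-b(t-s)\big)_+,\qquad t\ge0.$$ *)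

theory Defs
  imports "HOL-Probability.Probability"
begin

text \<open>
  A Poisson point process is a family of integer-valued measures on the space of the intensity
  \<open>\<nu>\<close>.  The probabilities in \<open>poisson\<close> are written out because \<open>poisson_pmf\<close> requires a positive
  rate; for rate 0 the convention \<open>0 ^ 0 = 1\<close> gives the point mass at 0.  Sets of infinite
  intensity carry infinitely many points.
\<close>

locale poisson_point_process = prob_space P
  for P :: "'w measure" and \<nu> :: "'e measure" and N :: "'w \<Rightarrow> 'e measure" +
  assumes sets_eq: "\<And>\<omega>. \<omega> \<in> space P \<Longrightarrow> sets (N \<omega>) = sets \<nu>"
    and integer_valued:
      "\<And>\<omega> A. \<omega> \<in> space P \<Longrightarrow> A \<in> sets \<nu> \<Longrightarrow> emeasure (N \<omega>) A \<in> insert \<infinity> (range of_nat)"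
    and measurable_count:
      "\<And>A. A \<in> sets \<nu> \<Longrightarrow> (\<lambda>\<omega>. emeasure (N \<omega>) A) \<in> borel_measurable P"
    and poisson:
      "\<And>A k. A \<in> sets \<nu> \<Longrightarrow> emeasure \<nu> A < \<infinity> \<Longrightarrow>
        prob {\<omega> \<in> space P. emeasure (N \<omega>) A = of_nat k} =
          measure \<nu> A ^ k / fact k * exp (- measure \<nu> A)"
    and poisson_infinite:
      "\<And>A. A \<in> sets \<nu> \<Longrightarrow> emeasure \<nu> A = \<infinity> \<Longrightarrow> AE \<omega> in P. emeasure (N \<omega>) A = \<infinity>"
    and independent_increments:
      "\<And>(A :: nat \<Rightarrow> 'e set) n. (\<And>i. i < n \<Longrightarrow> A i \<in> sets \<nu>) \<Longrightarrow> disjoint_family_on A {..<n} \<Longrightarrow>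
        indep_vars (\<lambda>_. borel) (\<lambda>i \<omega>. emeasure (N \<omega>) (A i)) {..<n}"

definition esn_intensity :: "real measure \<Rightarrow> (real \<times> real) measure" where
  "esn_intensity \<mu> = restrict_space lborel {0..} \<Otimes>\<^sub>M \<mu>"

text \<open>
  The measure \<open>\<Sum>\<^bsub>s \<ge> 0\<^esub> \<delta>\<^bsub>(s, \<xi> s)\<^esub>\<close>, where \<open>\<xi> s = 0\<close> encodes that there is no atom at time \<open>s\<close>:
  a sum of Dirac measures is the image of a counting measure.
\<close>

definition atom_sum :: "(real \<times> real) measure \<Rightarrow> (real \<Rightarrow> real) \<Rightarrow> (real \<times> real) measure" where
  "atom_sum \<nu> \<xi> = distr (count_space {s. 0 \<le> s \<and> 0 < \<xi> s}) \<nu> (\<lambda>s. (s, \<xi> s))"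

text \<open>
  The supremum is taken in the extended reals because \<open>\<xi>\<close> may be unbounded on \<open>[0, t]\<close> on a
  null set, where a supremum in \<open>real\<close> would be unspecified.
\<close>

definition esn :: "real \<Rightarrow> (real \<Rightarrow> real) \<Rightarrow> real \<Rightarrow> ereal" where
  "esn b \<xi> t = (SUP s\<in>{0..t}. ereal (max (\<xi> s - b * (t - s)) 0))"

end

theory Submission
  imports Defs
begin

text \<open>
  Let \<open>R\<close> be the set of times \<open>t \<ge> 0\<close> outside all open intervals \<open>(s, s + \<xi> s / b)\<close>, and \<open>Z\<close> the zero set of
  the process. A time \<open>t\<close> is a zero if and only if it avoids the half-open intervals
  \<open>[s, s + \<xi> s / b)\<close> of all atoms, so \<open>Z\<close> is \<open>R\<close> without the atom times. Since \<open>R\<close> is closed, it contains the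
  closure of \<open>Z\<close>, and what must be shown is that almost surely every uncovered atom time is a limit
  of zeros. Such a time is positive, because almost surely there is no atom at time 0.

  This has a topological half and a probabilistic half. The probabilistic half is that almost surely
  no uncovered atom time \<open>s\<close> is isolated from the left in \<open>R\<close>. Suppose \<open>s\<close> is one, with size at least
  \<open>\<epsilon>\<close>. Atoms of size at least \<open>\<epsilon>\<close> are locally finite, so there is a rational \<open>p < s\<close> such that \<open>[p, s)\<close> is
  covered and \<open>s\<close> is the first atom of size at least \<open>\<epsilon>\<close> after \<open>p\<close>. Then \<open>s\<close> is the first time after \<open>p\<close>
  that is left uncovered by the atoms up to \<open>p\<close> and the atoms smaller than \<open>\<epsilon>\<close>. That time is
  independent of the atoms after \<open>p\<close> of size at least \<open>\<epsilon>\<close>, and no fixed time carries such an atom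
  with positive probability, so the coincidence has probability zero. Instead of handling the random time itself, one asks in which
  cell of a grid of mesh \<open>h\<close> the covering stops (\<open>prob_hit_le\<close>); the coincidence then has
  probability at most \<open>h\<close> times the rate of atoms of size at least \<open>\<epsilon>\<close>, and \<open>h\<close> tends to zero.
  Independence is needed only for vacuum events, which form a system closed under intersection
  (\<open>prob_Diff_vacuum\<close>, \<open>covered_in_early\<close>).

  The topological half (\<open>closure_esn_zeros\<close>) passes from \<open>R\<close> to \<open>Z\<close>. If an uncovered atom time
  were at positive distance from \<open>Z\<close>, a nonempty compact slice of \<open>R\<close> ending there would consist of atom
  times only and so would be countable. By the Baire property it has an isolated point, and this is
  an uncovered atom time isolated from the left in \<open>R\<close>, which the probabilistic half excludes.
\<close>

section \<open>The zero set and the uncovered set\<close>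

text \<open>
  Otherwise every set \<open>S - {x}\<close> would be open and dense in \<open>S\<close>. There are countably many of them and
  their intersection is empty, against the Baire property.
\<close>

lemma countable_closed_has_isolated_point:
  fixes S :: "'a::{real_normed_vector,heine_borel} set"
  assumes "closed S" "countable S" "S \<noteq> {}"
  obtains x where "x \<in> S" "\<not> x islimpt S"
proof -
  have False if perf: "\<And>x. x \<in> S \<Longrightarrow> x islimpt S"
  proof -
    define G where "G = (\<lambda>x. S - {x}) ` S"
    have "S \<subseteq> closure (\<Inter>G)"
    proof (rule Baire)
      show "closed S" "countable G"
        using assms by (auto simp: G_def)
    next
      fix T assume "T \<in> G"
      then obtain x where x: "x \<in> S" "T = S - {x}" by (auto simp: G_def)
      have "openin (top_of_set S) T"
        unfolding x by (auto simp: openin_open intro!: exI[of _ "- {x}"])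
      moreover have "x \<in> closure T"
        using perf[OF x(1)] unfolding x by (simp add: closure_def islimpt_punctured[symmetric])
      hence "S \<subseteq> closure T"
        using closure_subset[of T] by (auto simp: x)
      ultimately show "openin (top_of_set S) T \<and> S \<subseteq> closure T" by blast
    qed
    moreover have "\<Inter>G = {}"
      using \<open>S \<noteq> {}\<close> by (auto simp: G_def)
    ultimately show False using \<open>S \<noteq> {}\<close> by simp
  qed
  thus thesis using that by blast
qed

definition uncovered :: "real \<Rightarrow> (real \<Rightarrow> real) \<Rightarrow> real set" where
  "uncovered b \<xi> = {0..} - (\<Union>s\<in>{0..}. {s<..<s + \<xi> s / b})"

lemma uncovered_iff:
  "t \<in> uncovered b \<xi> \<longleftrightarrow> 0 \<le> t \<and> (\<forall>s. 0 \<le> s \<longrightarrow> s < t \<longrightarrow> s + \<xi> s / b \<le> t)"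
  by (force simp: uncovered_def)

lemma closed_uncovered: "closed (uncovered b \<xi>)"
  unfolding uncovered_def by (intro closed_Diff closed_atLeast open_UN ballI open_greaterThanLessThan)

lemma esn_eq_0_iff:
  assumes "b > 0" "t \<ge> 0"
  shows "esn b \<xi> t = 0 \<longleftrightarrow> (\<forall>s. 0 \<le> s \<longrightarrow> s \<le> t \<longrightarrow> s + \<xi> s / b \<le> t)"
proof -
  have "0 \<le> esn b \<xi> t"
    unfolding esn_def using assms by (intro SUP_upper2[of 0]) (auto simp: zero_ereal_def)
  hence "esn b \<xi> t = 0 \<longleftrightarrow> esn b \<xi> t \<le> 0" by auto
  also have "\<dots> \<longleftrightarrow> (\<forall>s. 0 \<le> s \<longrightarrow> s \<le> t \<longrightarrow> \<xi> s \<le> b * (t - s))"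
    by (auto simp: esn_def SUP_le_iff zero_ereal_def)
  also have "\<dots> \<longleftrightarrow> (\<forall>s. 0 \<le> s \<longrightarrow> s \<le> t \<longrightarrow> s + \<xi> s / b \<le> t)"
    using assms(1) by (simp add: field_simps)
  finally show ?thesis .
qed

text \<open>
  At a zero \<open>t\<close> the process excludes the half-open intervals \<open>[s, s + \<xi> s / b)\<close>, whereas
  \<^const>\<open>uncovered\<close> excludes the open ones. The two sets therefore differ exactly in the left
  endpoints, that is, in the atom times.
\<close>

lemma esn_zeros_eq:
  assumes "b > 0" and nonneg: "\<And>s. s \<ge> 0 \<Longrightarrow> \<xi> s \<ge> 0"
  shows "{t. t \<ge> 0 \<and> esn b \<xi> t = 0} = uncovered b \<xi> - {s. \<xi> s > 0}"
proof (intro equalityI subsetI)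
  fix t assume "t \<in> {t. t \<ge> 0 \<and> esn b \<xi> t = 0}"
  hence t: "0 \<le> t" "\<And>s. 0 \<le> s \<Longrightarrow> s \<le> t \<Longrightarrow> s + \<xi> s / b \<le> t"
    using esn_eq_0_iff[OF \<open>b > 0\<close>] by auto
  have "\<xi> t \<le> 0" using t(2)[of t] t(1) \<open>b > 0\<close> by (simp add: field_simps)
  thus "t \<in> uncovered b \<xi> - {s. \<xi> s > 0}" using t by (auto simp: uncovered_iff)
next
  fix t assume t: "t \<in> uncovered b \<xi> - {s. \<xi> s > 0}"
  hence "\<xi> t = 0" using nonneg[of t] by (force simp: uncovered_iff)
  hence "s + \<xi> s / b \<le> t" if "0 \<le> s" "s \<le> t" for s
    using that t by (cases "s = t") (auto simp: uncovered_iff)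
  thus "t \<in> {t. t \<ge> 0 \<and> esn b \<xi> t = 0}"
    using t esn_eq_0_iff[OF \<open>b > 0\<close>] by (auto simp: uncovered_iff)
qed

text \<open>
  If there were no zeros just before an uncovered atom time, all uncovered points there would be atom
  times. They would form a countable closed set, and the hypothesis \<open>dense\<close> rules out the isolated
  point that such a set must have. That hypothesis looks to the left
  alone because an atom of size \<open>\<xi> s\<close> covers the interval immediately after \<open>s\<close>.
\<close>

lemma closure_esn_zeros:
  assumes "b > 0" and nonneg: "\<And>s. s \<ge> 0 \<Longrightarrow> \<xi> s \<ge> 0"
    and zero: "\<xi> 0 = 0"
    and countable: "countable {s. s \<ge> 0 \<and> \<xi> s > 0}"
    and dense: "\<And>s p. s \<in> uncovered b \<xi> \<Longrightarrow> \<xi> s > 0 \<Longrightarrow> 0 \<le> p \<Longrightarrow> p < s \<Longrightarrow> uncovered b \<xi> \<inter> {p<..<s} \<noteq> {}"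
  shows "closure {t. t \<ge> 0 \<and> esn b \<xi> t = 0} = uncovered b \<xi>"
proof -
  define R where "R = uncovered b \<xi>"
  define Z where "Z = R - {s. \<xi> s > 0}"
  have "r \<in> closure Z" if r: "r \<in> R" for r
  proof (rule ccontr)
    assume "r \<notin> closure Z"
    then obtain e where "e > 0" and e: "\<And>t. t \<in> Z \<Longrightarrow> dist t r \<ge> e"
      unfolding closure_approachable by force
    have r0: "r \<ge> 0" using r by (simp add: R_def uncovered_iff)
    have "\<xi> r > 0"
      using e[of r] r \<open>e > 0\<close> by (auto simp: Z_def)
    with r0 zero have "r > 0" by (cases "r = 0") auto
    define q where "q = max 0 (r - e)"
    have "q < r" "q \<ge> 0" using \<open>r > 0\<close> \<open>e > 0\<close> by (auto simp: q_def)
    \<comment> \<open>No zero lies in the window, so every uncovered point in it is one of the countably many atom times.\<close>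
    have atoms: "\<xi> t > 0" if "t \<in> R" "q < t" "t \<le> r" for t
      using e[of t] that by (fastforce simp: Z_def q_def dist_real_def)
    have "uncountable {q<..<r}" using \<open>q < r\<close> by (simp add: uncountable_open_interval)
    moreover have "countable (R \<inter> {q<..<r})"
      by (rule countable_subset[OF _ countable]) (use atoms \<open>q \<ge> 0\<close> in auto)
    ultimately obtain p where p: "q < p" "p < r" "p \<notin> R"
      by (metis Int_absorb1 greaterThanLessThan_iff subsetI)
    \<comment> \<open>Because \<open>p \<notin> R\<close>, an isolated point of this slice is isolated from the left in \<open>R\<close> as well.\<close>
    have "\<exists>x. x \<in> R \<inter> {p..r} \<and> \<not> x islimpt (R \<inter> {p..r})"
    proof (rule countable_closed_has_isolated_point)
      show "closed (R \<inter> {p..r})" by (auto simp: R_def intro!: closed_Int closed_uncovered)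
      show "countable (R \<inter> {p..r})"
        by (rule countable_subset[OF _ countable]) (use atoms \<open>q \<ge> 0\<close> p in force)
      show "R \<inter> {p..r} \<noteq> {}" using r p by auto
    qed blast
    then obtain x where x: "x \<in> R" "p \<le> x" "x \<le> r" "\<not> x islimpt (R \<inter> {p..r})" by auto
    have "p < x" using x p by (cases "x = p") auto
    have "x islimpt (R \<inter> {p..r})"
      unfolding islimpt_approachable
    proof (intro allI impI)
      fix d :: real assume "d > 0"
      have "R \<inter> {max p (x - d)<..<x} \<noteq> {}"
        unfolding R_def
        using x atoms[of x] \<open>p < x\<close> p \<open>q \<ge> 0\<close> \<open>d > 0\<close>
        by (intro dense) (auto simp: R_def)
      then obtain y where "y \<in> R" "p < y" "x - d < y" "y < x" by auto
      thus "\<exists>y\<in>R \<inter> {p..r}. y \<noteq> x \<and> dist y x < d"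
        using x by (intro bexI[of _ y]) (auto simp: dist_real_def)
    qed
    with x show False by simp
  qed
  moreover have "closure Z \<subseteq> R"
    by (rule closure_minimal) (auto simp: Z_def R_def closed_uncovered)
  ultimately have "closure Z = R" by auto
  moreover have "{t. t \<ge> 0 \<and> esn b \<xi> t = 0} = Z"
    unfolding Z_def R_def using \<open>b > 0\<close> nonneg by (rule esn_zeros_eq)
  ultimately show ?thesis by (simp add: R_def)
qed

section \<open>Vacuum events of a Poisson point process\<close>

context poisson_point_process
begin

definition vacuum :: "'e set \<Rightarrow> 'w set" where
  "vacuum A = {\<omega> \<in> space P. emeasure (N \<omega>) A = 0}"

lemma vacuum_in_events [measurable]: "A \<in> sets \<nu> \<Longrightarrow> vacuum A \<in> events"
  unfolding vacuum_def using measurable_count by measurable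

lemma vacuum_Int:
  assumes "A \<in> sets \<nu>" "B \<in> sets \<nu>"
  shows "vacuum A \<inter> vacuum B = vacuum (A \<union> B)"
proof (intro equalityI subsetI)
  fix \<omega> assume "\<omega> \<in> vacuum A \<inter> vacuum B"
  hence "\<omega> \<in> space P" "A \<in> null_sets (N \<omega>)" "B \<in> null_sets (N \<omega>)"
    using assms by (auto simp: vacuum_def sets_eq)
  thus "\<omega> \<in> vacuum (A \<union> B)"
    using null_sets.Un[of A "N \<omega>" B] by (auto simp: vacuum_def)
next
  fix \<omega> assume "\<omega> \<in> vacuum (A \<union> B)"
  hence \<omega>: "\<omega> \<in> space P" and null: "emeasure (N \<omega>) (A \<union> B) = 0"
    by (auto simp: vacuum_def)
  have "emeasure (N \<omega>) C \<le> emeasure (N \<omega>) (A \<union> B)" if "C \<subseteq> A \<union> B" for C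
    using that assms by (intro emeasure_mono) (auto simp: sets_eq[OF \<omega>])
  from this[of A] this[of B] show "\<omega> \<in> vacuum A \<inter> vacuum B"
    using \<omega> null by (simp add: vacuum_def)
qed

lemma prob_vacuum:
  assumes "A \<in> sets \<nu>" "emeasure \<nu> A < \<infinity>"
  shows "prob (vacuum A) = exp (- measure \<nu> A)"
  using poisson[OF assms, of 0] by (simp add: vacuum_def)

lemma prob_vacuum_Int:
  assumes "A \<in> sets \<nu>" "B \<in> sets \<nu>" "A \<inter> B = {}"
  shows "prob (vacuum A \<inter> vacuum B) = prob (vacuum A) * prob (vacuum B)"
proof -
  define F where "F i = (if i = (0::nat) then A else B)" for i
  have "indep_vars (\<lambda>_. borel) (\<lambda>i \<omega>. emeasure (N \<omega>) (F i)) {..<2}"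
    using assms by (intro independent_increments) (auto simp: F_def disjoint_family_on_def)
  from indep_varsD_finite[OF this, of "\<lambda>_. {0}"]
  show ?thesis
    by (simp add: numeral_2_eq_2 lessThan_Suc F_def vacuum_def vimage_def Int_def conj_ac)
qed

text \<open>
  Vacuum events are closed under intersection by the lemma \<open>vacuum_Int\<close>, so independence of two
  disjoint regions extends from single vacuum events to the \<open>\<sigma>\<close>-algebra that those inside \<open>E\<close>
  generate. This replaces the joint law of counts over overlapping sets.
\<close>

lemma prob_Diff_vacuum:
  assumes U: "U \<in> sigma_sets (space P) {vacuum A |A. A \<in> sets \<nu> \<and> A \<subseteq> E}"
    and B: "B \<in> sets \<nu>" "B \<inter> E = {}"
  shows "prob (U - vacuum B) = prob U * (1 - prob (vacuum B))"
proof -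
  let ?G = "{vacuum A |A. A \<in> sets \<nu> \<and> A \<subseteq> E}"
  have "indep_set (sigma_sets (space P) ?G) (sigma_sets (space P) {vacuum B})"
  proof (rule indep_set_sigma_sets)
    show "indep_set ?G {vacuum B}"
    proof (rule indep_setI)
      fix a b assume "a \<in> ?G" "b \<in> {vacuum B}"
      then obtain A where "A \<in> sets \<nu>" "A \<subseteq> E" "a = vacuum A" "b = vacuum B" by auto
      thus "prob (a \<inter> b) = prob a * prob b"
        using B by (auto intro!: prob_vacuum_Int)
    qed (use B in auto)
    show "Int_stable ?G"
    proof (rule Int_stableI)
      fix a b assume "a \<in> ?G" "b \<in> ?G"
      then obtain A A' where "A \<in> sets \<nu>" "A \<subseteq> E" "a = vacuum A" "A' \<in> sets \<nu>" "A' \<subseteq> E" "b = vacuum A'"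
        by auto
      thus "a \<inter> b \<in> ?G" by (auto simp: vacuum_Int intro!: exI[of _ "A \<union> A'"])
    qed
    show "Int_stable {vacuum B}" by (auto simp: Int_stable_def)
  qed
  hence "prob (U \<inter> vacuum B) = prob U * prob (vacuum B)"
    using U by (rule indep_setD) auto
  moreover have "U \<in> events"
    using U sets.sigma_sets_subset[of ?G P] by (auto intro: vacuum_in_events)
  hence "prob (U - vacuum B) = prob U - prob (U \<inter> vacuum B)"
    using B by (intro finite_measure_Diff') auto
  ultimately show ?thesis by (simp add: algebra_simps)
qed

lemma AE_vacuum:
  assumes "A \<in> null_sets \<nu>"
  shows "AE \<omega> in P. emeasure (N \<omega>) A = 0"
proof -
  have "A \<in> sets \<nu>" "emeasure \<nu> A = 0" "measure \<nu> A = 0"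
    using assms by (auto simp: measure_eq_0_null_sets)
  hence "prob (vacuum A) = 1"
    using prob_vacuum[of A] by simp
  from AE_prob_1[OF this] show ?thesis
    by eventually_elim (auto simp: vacuum_def)
qed

text \<open>
  The Poisson weights sum to 1, which leaves no mass for the value \<open>\<infinity>\<close>.
\<close>

lemma AE_finite_count:
  assumes A: "A \<in> sets \<nu>" "emeasure \<nu> A < \<infinity>"
  shows "AE \<omega> in P. emeasure (N \<omega>) A < \<infinity>"
proof -
  define F where "F k = {\<omega> \<in> space P. emeasure (N \<omega>) A = of_nat k}" for k
  define l where "l = measure \<nu> A"
  have F: "F k \<in> events" for k
    unfolding F_def using measurable_count[OF A(1)] by measurable
  have disj: "disjoint_family F" 
    by (auto simp: disjoint_family_on_def F_def)
  have "(\<lambda>k. prob (F k)) sums prob (\<Union>k. F k)"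
    using F disj by (intro finite_measure_UNION) auto
  moreover have "(\<lambda>k. exp (- l) * (l ^ k /\<^sub>R fact k)) sums (exp (- l) * exp l)"
    by (intro sums_mult exp_converges)
  hence "(\<lambda>k. prob (F k)) sums 1"
    unfolding F_def poisson[OF A] l_def[symmetric]
    by (simp add: exp_minus field_simps)
  ultimately have "prob (\<Union>k. F k) = 1" by (rule sums_unique2)
  from AE_prob_1[OF this] show ?thesis
    by eventually_elim (auto simp: F_def of_nat_less_top)
qed

end

section \<open>Coverage by early atoms\<close>

lemma exists_one_over_Suc_le:
  assumes "(x::real) > 0"
  obtains n where "1 / real (Suc n) \<le> x" "0 < 1 / real (Suc n)"
proof -
  obtain n where "inverse (real (Suc n)) < x" using reals_Archimedean[OF assms] by blast
  thus thesis by (intro that[of n]) (simp_all add: inverse_eq_divide)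
qed

locale esn_driver = poisson_point_process P "esn_intensity \<mu>" N
  for b :: real and \<mu> :: "real measure" and P :: "'w measure"
    and N :: "'w \<Rightarrow> (real \<times> real) measure" +
  assumes b_pos: "b > 0"
    and sets_\<mu>: "sets \<mu> = sets (restrict_space borel {0<..})"
    and tail_finite: "\<And>x. x > 0 \<Longrightarrow> emeasure \<mu> {x..} < \<infinity>"
begin

abbreviation \<nu> where "\<nu> \<equiv> esn_intensity \<mu>"

lemma space_\<mu>: "space \<mu> = {0<..}"
  using sets_eq_imp_space_eq[OF sets_\<mu>] by (simp add: space_restrict_space)

lemma space_\<nu>: "space \<nu> = {0..} \<times> {0<..}"
  by (simp add: esn_intensity_def space_pair_measure space_\<mu> space_restrict_space)

lemma tail_in_sets: "x > 0 \<Longrightarrow> {x..} \<in> sets \<mu>"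
  by (auto simp: sets_\<mu> sets_restrict_space_iff)

lemma measurable_fst_\<nu> [measurable]: "fst \<in> borel_measurable \<nu>"
proof -
  have "(\<lambda>x. x) \<in> borel_measurable (restrict_space lborel {0::real..})"
    by (intro measurable_restrict_space1) auto
  from measurable_compose[OF measurable_fst this] show ?thesis
    unfolding esn_intensity_def .
qed

lemma measurable_snd_\<nu> [measurable]: "snd \<in> borel_measurable \<nu>"
proof -
  have "(\<lambda>x. x) \<in> borel_measurable (restrict_space borel {0::real<..})"
    by (intro measurable_restrict_space1) auto
  hence "(\<lambda>x. x) \<in> borel_measurable \<mu>"
    by (simp add: measurable_def sets_\<mu> sets_eq_imp_space_eq[OF sets_\<mu>])
  from measurable_compose[OF measurable_snd this] show ?thesis
    unfolding esn_intensity_def .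
qed

lemma sigma_finite_\<mu>: "sigma_finite_measure \<mu>"
proof
  show "\<exists>A. countable A \<and> A \<subseteq> sets \<mu> \<and> \<Union> A = space \<mu> \<and> (\<forall>a\<in>A. emeasure \<mu> a \<noteq> \<infinity>)"
  proof (intro exI[of _ "range (\<lambda>n. {1 / real (Suc n)..})"] conjI ballI)
    show "\<Union> (range (\<lambda>n. {1 / real (Suc n)..})) = space \<mu>"
    proof (intro equalityI subsetI)
      fix x assume "x \<in> space \<mu>"
      hence "x > 0" by (simp add: space_\<mu>)
      then obtain n where "1 / real (Suc n) \<le> x" by (rule exists_one_over_Suc_le)
      thus "x \<in> \<Union> (range (\<lambda>n. {1 / real (Suc n)..}))"
        by (intro UN_I[of n]) simp_all
    next
      fix x assume "x \<in> \<Union> (range (\<lambda>n. {1 / real (Suc n)..}))"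
      then obtain n where "1 / real (Suc n) \<le> x" by auto
      moreover have "0 < 1 / real (Suc n)" by simp
      ultimately show "x \<in> space \<mu>" unfolding space_\<mu> by (simp only: greaterThan_iff)
    qed
  next
    fix a assume "a \<in> range (\<lambda>n. {1 / real (Suc n)..})"
    then obtain n where "a = {1 / real (Suc n)..}" by blast
    thus "emeasure \<mu> a \<noteq> \<infinity>" using tail_finite[of "1 / real (Suc n)"] by simp
  next
    show "range (\<lambda>n. {1 / real (Suc n)..}) \<subseteq> sets \<mu>"
      by (intro image_subsetI tail_in_sets) simp
  qed simp
qed

lemma
  assumes "T \<in> sets borel" "T \<subseteq> {0..}" "\<epsilon> > 0"
  shows box_in_sets: "T \<times> {\<epsilon>..} \<in> sets \<nu>"
    and emeasure_box: "emeasure \<nu> (T \<times> {\<epsilon>..}) = emeasure lborel T * ennreal (measure \<mu> {\<epsilon>..})"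
proof -
  interpret sigma_finite_measure \<mu> by (rule sigma_finite_\<mu>)
  have T: "T \<in> sets (restrict_space lborel {0..})"
    using assms by (auto simp: sets_restrict_space_iff)
  show "T \<times> {\<epsilon>..} \<in> sets \<nu>"
    unfolding esn_intensity_def using T tail_in_sets[OF \<open>\<epsilon> > 0\<close>] by simp
  have "emeasure \<nu> (T \<times> {\<epsilon>..}) = emeasure (restrict_space lborel {0..}) T * emeasure \<mu> {\<epsilon>..}"
    unfolding esn_intensity_def
    using T tail_in_sets[OF \<open>\<epsilon> > 0\<close>] by (rule emeasure_pair_measure_Times)
  also have "emeasure (restrict_space lborel {0..}) T = emeasure lborel T"
    using assms by (intro emeasure_restrict_space) auto
  also have "emeasure \<mu> {\<epsilon>..} = ennreal (measure \<mu> {\<epsilon>..})"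
    using tail_finite[OF \<open>\<epsilon> > 0\<close>] by (intro emeasure_eq_ennreal_measure) auto
  finally show "emeasure \<nu> (T \<times> {\<epsilon>..}) = emeasure lborel T * ennreal (measure \<mu> {\<epsilon>..})" .
qed

text \<open>
  The part of the point process that is independent of the first atom of size at least \<open>\<epsilon>\<close> after
  time \<open>p\<close>: all atoms up to \<open>p\<close> and, after \<open>p\<close>, only those smaller than \<open>\<epsilon>\<close>.
\<close>

definition early :: "real \<Rightarrow> real \<Rightarrow> (real \<times> real) set" where
  "early p \<epsilon> = {z \<in> space \<nu>. fst z \<le> p \<or> snd z < \<epsilon>}"

text \<open>
  For \<open>u < v\<close>, an atom lies in \<open>bridging u v\<close> if and only if its interval contains \<open>(u, v)\<close>.
\<close>

definition bridging :: "real \<Rightarrow> real \<Rightarrow> (real \<times> real) set" where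
  "bridging u v = {z \<in> space \<nu>. fst z \<le> u \<and> v \<le> fst z + snd z / b}"

definition early_bridging :: "real \<Rightarrow> real \<Rightarrow> rat \<times> rat \<Rightarrow> (real \<times> real) set" where
  "early_bridging p \<epsilon> r = early p \<epsilon> \<inter> bridging (of_rat (fst r)) (of_rat (snd r))"

text \<open>
  The event that the intervals of the early atoms cover \<open>[p, c]\<close>. It is phrased through rational
  intervals that are contained in the interval of some early atom; this makes it an event about
  countably many counts and refers to \<open>N\<close> alone, not to a labelling of its atoms.
\<close>

definition covered :: "real \<Rightarrow> real \<Rightarrow> real \<Rightarrow> 'w set" where
  "covered p \<epsilon> c = {\<omega> \<in> space P. {p..c} \<subseteq>
     (\<Union>r\<in>{r. emeasure (N \<omega>) (early_bridging p \<epsilon> r) \<noteq> 0}. {of_rat (fst r)<..<of_rat (snd r)})}"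

lemma early_bridging_in_sets: "early_bridging p \<epsilon> r \<in> sets \<nu>"
  unfolding early_bridging_def early_def bridging_def by (rule sets.Int) measurable

text \<open>
  By compactness of \<open>[p, c]\<close>, a cover by rational intervals has a finite subcover. Hence the event is
  a countable union, over the finite families of rational intervals that cover \<open>[p, c]\<close>, of finite
  intersections of complements of vacuum events.
\<close>

lemma covered_in_early:
  "covered p \<epsilon> c \<in> sigma_sets (space P) {vacuum A |A. A \<in> sets \<nu> \<and> A \<subseteq> early p \<epsilon>}"
proof -
  let ?G = "{vacuum A |A. A \<in> sets \<nu> \<and> A \<subseteq> early p \<epsilon>}"
  define M where "M = sigma (space P) ?G"
  have G: "?G \<subseteq> Pow (space P)" by (auto simp: vacuum_def)
  have [simp]: "space M = space P" by (simp add: M_def G space_measure_of)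
  have sets_M: "sets M = sigma_sets (space P) ?G" by (simp add: M_def G sets_measure_of)
  define \<F> where "\<F> = {F :: (rat \<times> rat) set. finite F \<and>
    {p..c} \<subseteq> (\<Union>r\<in>F. {of_rat (fst r)<..<of_rat (snd r)})}"
  have "countable \<F>"
    by (rule countable_subset[OF _ countable_Collect_finite]) (auto simp: \<F>_def)
  have vac: "{\<omega> \<in> space M. emeasure (N \<omega>) (early_bridging p \<epsilon> r) \<noteq> 0} \<in> sets M" for r
  proof -
    have "vacuum (early_bridging p \<epsilon> r) \<in> sets M"
      unfolding sets_M by (intro sigma_sets.Basic) (use early_bridging_in_sets[of p \<epsilon> r] in \<open>auto simp: early_bridging_def\<close>)
    hence "space M - vacuum (early_bridging p \<epsilon> r) \<in> sets M" by (rule sets.compl_sets)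
    also have "space M - vacuum (early_bridging p \<epsilon> r) =
        {\<omega> \<in> space M. emeasure (N \<omega>) (early_bridging p \<epsilon> r) \<noteq> 0}"
      by (auto simp: vacuum_def)
    finally show ?thesis .
  qed
  have "covered p \<epsilon> c = {\<omega> \<in> space M. \<exists>F\<in>\<F>. \<forall>r\<in>F. emeasure (N \<omega>) (early_bridging p \<epsilon> r) \<noteq> 0}"
    (is "_ = ?R")
  proof (intro equalityI subsetI)
    fix \<omega> assume \<omega>: "\<omega> \<in> covered p \<epsilon> c"
    let ?C = "{r. emeasure (N \<omega>) (early_bridging p \<epsilon> r) \<noteq> 0}"
    have "{p..c} \<subseteq> (\<Union>r\<in>?C. {of_rat (fst r)<..<of_rat (snd r)})"
      using \<omega> by (simp only: covered_def mem_Collect_eq)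
    then obtain F where "F \<subseteq> ?C" "finite F" "{p..c} \<subseteq> (\<Union>r\<in>F. {of_rat (fst r)<..<of_rat (snd r)})"
      by (rule compactE_image[OF compact_Icc, of ?C "\<lambda>r. {of_rat (fst r)<..<of_rat (snd r)}", rotated])
        (blast, rule open_greaterThanLessThan)
    hence "F \<in> \<F>" "\<forall>r\<in>F. emeasure (N \<omega>) (early_bridging p \<epsilon> r) \<noteq> 0"
      unfolding \<F>_def by blast+
    moreover have "\<omega> \<in> space M" using \<omega> by (simp only: covered_def mem_Collect_eq \<open>space M = space P\<close>)
    ultimately show "\<omega> \<in> ?R" by blast
  next
    fix \<omega> assume "\<omega> \<in> ?R"
    then obtain F where F: "\<omega> \<in> space P" "F \<in> \<F>" "\<forall>r\<in>F. emeasure (N \<omega>) (early_bridging p \<epsilon> r) \<noteq> 0"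
      unfolding \<open>space M = space P\<close> by blast
    have "{p..c} \<subseteq> (\<Union>r\<in>F. {of_rat (fst r)<..<of_rat (snd r)})"
      using F(2) by (simp add: \<F>_def)
    also have "\<dots> \<subseteq> (\<Union>r\<in>{r. emeasure (N \<omega>) (early_bridging p \<epsilon> r) \<noteq> 0}. {of_rat (fst r)<..<of_rat (snd r)})"
      using F(3) by blast
    finally show "\<omega> \<in> covered p \<epsilon> c" using F(1) by (simp only: covered_def mem_Collect_eq)
  qed
  also have "\<dots> \<in> sets M"
  proof (rule sets.sets_Collect_countable_Ex'[OF _ \<open>countable \<F>\<close>])
    fix F assume "F \<in> \<F>"
    hence "finite F" by (simp add: \<F>_def)
    thus "{\<omega> \<in> space M. \<forall>r\<in>F. emeasure (N \<omega>) (early_bridging p \<epsilon> r) \<noteq> 0} \<in> sets M"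
      by (rule sets.sets_Collect_finite_All[OF vac])
  qed
  finally show ?thesis unfolding sets_M .
qed

section \<open>The end of a covered stretch almost surely carries no large atom\<close>

definition strip :: "real \<Rightarrow> real \<Rightarrow> real \<Rightarrow> nat \<Rightarrow> (real \<times> real) set" where
  "strip p \<epsilon> h k = {p + real k * h<..p + real (Suc k) * h} \<times> {\<epsilon>..}"

text \<open>
  The discretisation of a coincidence on the grid of mesh \<open>h\<close>: the early atoms cover from \<open>p\<close>
  continuously up to somewhere in the \<open>k\<close>-th cell but not through it, and an atom of size at least
  \<open>\<epsilon>\<close> occurs in that same cell.
\<close>

definition hit :: "real \<Rightarrow> real \<Rightarrow> real \<Rightarrow> 'w set" where
  "hit p \<epsilon> h = (\<Union>k. covered p \<epsilon> (p + real k * h) - covered p \<epsilon> (p + real (Suc k) * h)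
     - vacuum (strip p \<epsilon> h k))"

lemma covered_in_events: "covered p \<epsilon> c \<in> events"
  using covered_in_early[of p \<epsilon> c] sets.sigma_sets_subset[of "{vacuum A |A. A \<in> sets \<nu> \<and> A \<subseteq> early p \<epsilon>}" P]
  by (auto intro: vacuum_in_events)

lemma covered_antimono:
  assumes "c \<le> d"
  shows "covered p \<epsilon> d \<subseteq> covered p \<epsilon> c"
proof
  fix \<omega> assume "\<omega> \<in> covered p \<epsilon> d"
  moreover have "{p..c} \<subseteq> {p..d}" using assms by simp
  ultimately show "\<omega> \<in> covered p \<epsilon> c"
    unfolding covered_def mem_Collect_eq by (blast intro: order_trans)
qed

lemma
  assumes "p \<ge> 0" "\<epsilon> > 0" "h > 0"
  shows strip_in_sets: "strip p \<epsilon> h k \<in> sets \<nu>"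
    and emeasure_strip: "emeasure \<nu> (strip p \<epsilon> h k) = ennreal (h * measure \<mu> {\<epsilon>..})"
proof -
  define T where "T = {p + real k * h<..p + real (Suc k) * h}"
  have "0 \<le> p + real k * h" using assms by simp
  hence T: "T \<in> sets borel" "T \<subseteq> {0..}" by (auto simp: T_def)
  show "strip p \<epsilon> h k \<in> sets \<nu>"
    using box_in_sets[OF T \<open>\<epsilon> > 0\<close>] by (simp add: strip_def T_def)
  have "p + real k * h \<le> p + real (Suc k) * h"
    using assms by (simp add: mult_right_mono)
  hence "emeasure lborel T = ennreal (p + real (Suc k) * h - (p + real k * h))"
    unfolding T_def by (rule emeasure_lborel_Ioc)
  also have "p + real (Suc k) * h - (p + real k * h) = h" by (simp add: algebra_simps)
  finally show "emeasure \<nu> (strip p \<epsilon> h k) = ennreal (h * measure \<mu> {\<epsilon>..})"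
    using emeasure_box[OF T \<open>\<epsilon> > 0\<close>] assms by (simp add: strip_def T_def ennreal_mult)
qed

lemma hit_in_events:
  assumes "p \<ge> 0" "\<epsilon> > 0" "h > 0"
  shows "hit p \<epsilon> h \<in> events"
  unfolding hit_def
  by (intro sets.countable_UN image_subsetI sets.Diff covered_in_events vacuum_in_events strip_in_sets assms)

text \<open>
  Covering stops for the first time in at most one cell, so the events \<open>D k\<close> below are disjoint. Given
  that it stops in cell \<open>k\<close>, the large atoms in that cell are independent of this and appear with
  probability at most their expected number \<open>h * measure \<mu> {\<epsilon>..}\<close>, which is the same for all cells.
\<close>

lemma prob_hit_le:
  assumes "p \<ge> 0" "\<epsilon> > 0" "h > 0"
  shows "prob (hit p \<epsilon> h) \<le> h * measure \<mu> {\<epsilon>..}"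
proof -
  define m where "m = h * measure \<mu> {\<epsilon>..}"
  have "m \<ge> 0" using assms by (simp add: m_def)
  define D where "D k = covered p \<epsilon> (p + real k * h) - covered p \<epsilon> (p + real (Suc k) * h)" for k
  have D: "D k \<in> events" for k
    unfolding D_def by (intro sets.Diff covered_in_events)
  have "disjoint_family D"
    unfolding disjoint_family_on_def
  proof (intro ballI impI)
    have *: "D i \<inter> D j = {}" if "i < j" for i j
    proof -
      have "p + real (Suc i) * h \<le> p + real j * h"
        using that assms by (intro add_left_mono mult_right_mono) auto
      from covered_antimono[OF this, of p \<epsilon>] show ?thesis unfolding D_def by blast
    qed
    fix i j :: nat assume "i \<noteq> j"
    then consider "i < j" | "j < i" by linarith
    thus "D i \<inter> D j = {}" by cases (use * in blast)+
  qed
  have le: "prob (D k - vacuum (strip p \<epsilon> h k)) \<le> m * prob (D k)" for k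
  proof -
    let ?G = "{vacuum A |A. A \<in> sets \<nu> \<and> A \<subseteq> early p \<epsilon>}"
    interpret G: sigma_algebra "space P" "sigma_sets (space P) ?G"
      by (rule sigma_algebra_sigma_sets) (auto simp: vacuum_def)
    have "D k \<in> sigma_sets (space P) ?G"
      unfolding D_def by (intro G.Diff covered_in_early)
    moreover have "strip p \<epsilon> h k \<inter> early p \<epsilon> = {}"
    proof -
      have "p + real k * h \<ge> p" using assms by simp
      thus ?thesis by (force simp: strip_def early_def)
    qed
    ultimately have "prob (D k - vacuum (strip p \<epsilon> h k)) = prob (D k) * (1 - prob (vacuum (strip p \<epsilon> h k)))"
      using assms by (intro prob_Diff_vacuum strip_in_sets)
    also have "prob (vacuum (strip p \<epsilon> h k)) = exp (- m)"
      using assms \<open>m \<ge> 0\<close> by (subst prob_vacuum) (auto simp: strip_in_sets emeasure_strip m_def measure_def)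
    also have "prob (D k) * (1 - exp (- m)) \<le> prob (D k) * m"
      using exp_ge_add_one_self[of "- m"] by (intro mult_left_mono) auto
    finally show ?thesis by (simp add: mult.commute)
  qed
  have sums: "(\<lambda>k. prob (D k)) sums prob (\<Union>k. D k)"
    by (rule finite_measure_UNION[OF _ \<open>disjoint_family D\<close>]) (rule image_subsetI, rule D)
  hence summable: "summable (\<lambda>k. m * prob (D k))"
    by (intro summable_mult sums_summable)
  have summable': "summable (\<lambda>k. prob (D k - vacuum (strip p \<epsilon> h k)))"
    by (rule summable_comparison_test'[OF summable, of 0]) (use le in auto)
  have "prob (hit p \<epsilon> h) \<le> (\<Sum>k. prob (D k - vacuum (strip p \<epsilon> h k)))"
    unfolding hit_def D_def[symmetric]
    by (rule finite_measure_subadditive_countably[OF _ summable'])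
       (intro image_subsetI sets.Diff D vacuum_in_events strip_in_sets assms)
  also have "\<dots> \<le> (\<Sum>k. m * prob (D k))"
    by (intro suminf_le le summable summable')
  also have "\<dots> = m * prob (\<Union>k. D k)"
    using sums by (simp add: suminf_mult sums_iff)
  also have "\<dots> \<le> m * 1"
    using \<open>m \<ge> 0\<close> by (intro mult_left_mono prob_le_1)
  finally show ?thesis by (simp add: m_def)
qed

text \<open>
  The probability that the end of the covered stretch and a large atom coincide at every mesh is at
  most a quantity proportional to \<open>h\<close>, for each \<open>h\<close>.
\<close>

lemma AE_not_always_hit:
  assumes "p \<ge> 0" "\<epsilon> > 0"
  shows "AE \<omega> in P. \<exists>h>0. \<omega> \<notin> hit p \<epsilon> h"
proof -
  define F where "F = (\<Inter>n. hit p \<epsilon> (1 / real (Suc n)))"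
  have F: "F \<in> events"
    unfolding F_def by (intro sets.countable_INT image_subsetI hit_in_events assms) auto
  have "prob F \<le> 1 / real (Suc n) * measure \<mu> {\<epsilon>..}" for n
  proof -
    have "prob F \<le> prob (hit p \<epsilon> (1 / real (Suc n)))"
      unfolding F_def by (intro finite_measure_mono hit_in_events assms) (blast, simp)
    also have "\<dots> \<le> 1 / real (Suc n) * measure \<mu> {\<epsilon>..}"
      by (intro prob_hit_le assms) auto
    finally show ?thesis .
  qed
  moreover have "(\<lambda>n. 1 / real (Suc n) * measure \<mu> {\<epsilon>..}) \<longlonglongrightarrow> 0 * measure \<mu> {\<epsilon>..}"
    by (intro tendsto_mult tendsto_const) (use LIMSEQ_inverse_real_of_nat in \<open>simp add: inverse_eq_divide\<close>)
  ultimately have "prob F \<le> 0"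
    by (intro LIMSEQ_le_const) auto
  hence "F \<in> null_sets P"
    using F by (auto simp: emeasure_eq_measure measure_le_0_iff)
  from AE_not_in[OF this] show ?thesis
  proof eventually_elim
    case (elim \<omega>)
    then obtain n where "\<omega> \<notin> hit p \<epsilon> (1 / real (Suc n))" by (auto simp: F_def)
    thus ?case by (intro exI[of _ "1 / real (Suc n)"]) auto
  qed
qed

section \<open>The closure of the zero set\<close>

lemma emeasure_atom_sum:
  assumes "A \<in> sets \<nu>"
  shows "emeasure (atom_sum \<nu> \<xi>) A = emeasure (count_space UNIV) {s. 0 \<le> s \<and> 0 < \<xi> s \<and> (s, \<xi> s) \<in> A}"
proof -
  let ?S = "{s. 0 \<le> s \<and> 0 < \<xi> s}"
  have "(\<lambda>s. (s, \<xi> s)) \<in> count_space ?S \<rightarrow>\<^sub>M \<nu>"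
    by (auto simp: space_\<nu>)
  hence "emeasure (atom_sum \<nu> \<xi>) A = emeasure (count_space ?S) ((\<lambda>s. (s, \<xi> s)) -` A \<inter> ?S)"
    unfolding atom_sum_def using assms by (simp add: emeasure_distr)
  also have "\<dots> = emeasure (count_space UNIV) ((\<lambda>s. (s, \<xi> s)) -` A \<inter> ?S)"
    by (simp add: emeasure_count_space)
  also have "(\<lambda>s. (s, \<xi> s)) -` A \<inter> ?S = {s. 0 \<le> s \<and> 0 < \<xi> s \<and> (s, \<xi> s) \<in> A}"
    by auto
  finally show ?thesis .
qed

lemma atom_sum_eq_0_iff:
  assumes "A \<in> sets \<nu>"
  shows "emeasure (atom_sum \<nu> \<xi>) A = 0 \<longleftrightarrow> (\<forall>s. 0 \<le> s \<longrightarrow> 0 < \<xi> s \<longrightarrow> (s, \<xi> s) \<notin> A)"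
  unfolding emeasure_atom_sum[OF assms] emeasure_count_space_eq_0 by auto

lemma atom_sum_finite_iff:
  assumes "A \<in> sets \<nu>"
  shows "emeasure (atom_sum \<nu> \<xi>) A < \<infinity> \<longleftrightarrow> finite {s. 0 \<le> s \<and> 0 < \<xi> s \<and> (s, \<xi> s) \<in> A}"
  unfolding emeasure_atom_sum[OF assms] by (simp add: emeasure_count_space less_top[symmetric])

text \<open>
  If the uncovered atom time \<open>s\<close> is preceded by a covered stretch \<open>[p, s)\<close> and is the first atom of size
  at least \<open>\<epsilon>\<close> after \<open>p\<close>, then all intervals covering that stretch come from early atoms, and covering
  stops exactly at \<open>s\<close>. This puts \<open>\<omega>\<close> in the coincidence event of every mesh.
\<close>

lemma left_isolated_atom_in_hit:
  assumes \<omega>: "\<omega> \<in> space P" and N: "N \<omega> = atom_sum \<nu> \<xi>"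
    and "h > 0" "p \<ge> 0" "\<epsilon> > 0" "p < s"
    and s: "s \<in> uncovered b \<xi>" "\<xi> s \<ge> \<epsilon>"
    and first: "\<And>s'. p < s' \<Longrightarrow> s' < s \<Longrightarrow> \<xi> s' < \<epsilon>"
    and gap: "uncovered b \<xi> \<inter> {p..<s} = {}"
  shows "\<omega> \<in> hit p \<epsilon> h"
proof -
  \<comment> \<open>The cell \<open>(p + k h, p + (k + 1) h]\<close> that contains \<open>s\<close>; the ceiling because cells are closed on the right.\<close>
  define k where "k = nat (\<lceil>(s - p) / h\<rceil> - 1)"
  have "(s - p) / h > 0" using assms by simp
  hence k: "real k = of_int \<lceil>(s - p) / h\<rceil> - 1"
    unfolding k_def by (simp add: of_nat_nat)
  have "real k < (s - p) / h" "(s - p) / h \<le> real (Suc k)"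
    using k by linarith+
  hence s_k: "p + real k * h < s" "s \<le> p + real (Suc k) * h"
    using \<open>h > 0\<close> by (simp_all add: field_simps)
  have "\<omega> \<in> covered p \<epsilon> (p + real k * h)"
    unfolding covered_def
  proof (intro CollectI conjI \<omega> subsetI)
    fix t assume t: "t \<in> {p..p + real k * h}"
    hence "t \<notin> uncovered b \<xi>" using gap s_k by auto
    then obtain s' where s': "0 \<le> s'" "s' < t" "t < s' + \<xi> s' / b"
      using t \<open>p \<ge> 0\<close> by (auto simp: uncovered_iff not_le)
    obtain u where u: "s' < of_rat u" "of_rat u < t" using of_rat_dense[OF s'(2)] by blast
    obtain v where v: "t < of_rat v" "of_rat v < s' + \<xi> s' / b" using of_rat_dense[OF s'(3)] by blast
    have "0 < \<xi> s' / b" using s' by linarith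
    hence pos: "0 < \<xi> s'" using b_pos by (simp add: zero_less_divide_iff)
    have "s' \<le> p \<or> \<xi> s' < \<epsilon>" using first[of s'] s' t s_k by fastforce
    hence "(s', \<xi> s') \<in> early_bridging p \<epsilon> (u, v)"
      using s' u v pos by (auto simp: early_bridging_def early_def bridging_def space_\<nu>)
    hence "emeasure (N \<omega>) (early_bridging p \<epsilon> (u, v)) \<noteq> 0"
      unfolding N atom_sum_eq_0_iff[OF early_bridging_in_sets] using s' pos by blast
    thus "t \<in> (\<Union>r\<in>{r. emeasure (N \<omega>) (early_bridging p \<epsilon> r) \<noteq> 0}. {of_rat (fst r)<..<of_rat (snd r)})"
      using u v by (intro UN_I[of "(u, v)"]) auto
  qed
  moreover have "\<omega> \<notin> covered p \<epsilon> (p + real (Suc k) * h)"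
  proof
    assume "\<omega> \<in> covered p \<epsilon> (p + real (Suc k) * h)"
    moreover have "s \<in> {p..p + real (Suc k) * h}" using s_k \<open>p < s\<close> by simp
    ultimately have "s \<in> (\<Union>r\<in>{r. emeasure (N \<omega>) (early_bridging p \<epsilon> r) \<noteq> 0}.
        {of_rat (fst r)<..<of_rat (snd r)})"
      unfolding covered_def mem_Collect_eq by (elim conjE) (rule subsetD)
    then obtain r where r: "emeasure (N \<omega>) (early_bridging p \<epsilon> r) \<noteq> 0"
        "of_rat (fst r) < s" "s < of_rat (snd r)"
      by (elim UN_E) (simp only: mem_Collect_eq greaterThanLessThan_iff)
    from r(1) obtain s' where "0 \<le> s'" "(s', \<xi> s') \<in> early_bridging p \<epsilon> r"
      unfolding N atom_sum_eq_0_iff[OF early_bridging_in_sets] by blast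
    hence "0 \<le> s'" "s' < s" "s < s' + \<xi> s' / b"
      using r by (auto simp: early_bridging_def bridging_def)
    thus False using s by (fastforce simp: uncovered_iff)
  qed
  moreover have "\<omega> \<notin> vacuum (strip p \<epsilon> h k)"
  proof -
    have "(s, \<xi> s) \<in> strip p \<epsilon> h k" using s s_k by (auto simp: strip_def)
    hence "emeasure (N \<omega>) (strip p \<epsilon> h k) \<noteq> 0"
      unfolding N atom_sum_eq_0_iff[OF strip_in_sets[OF \<open>p \<ge> 0\<close> \<open>\<epsilon> > 0\<close> \<open>h > 0\<close>]]
      using s \<open>p \<ge> 0\<close> \<open>p < s\<close> \<open>\<epsilon> > 0\<close> by (intro notI) (auto dest!: spec[of _ s])
    thus ?thesis by (simp add: vacuum_def)
  qed
  ultimately show ?thesis unfolding hit_def by blast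
qed

lemma AE_rational_not_always_hit:
  "AE \<omega> in P. \<forall>(q::rat) (n::nat). 0 \<le> q \<longrightarrow> (\<exists>h>0. \<omega> \<notin> hit (of_rat q) (1 / real (Suc n)) h)"
  unfolding AE_all_countable
proof (intro allI)
  fix q :: rat and n :: nat
  show "AE \<omega> in P. 0 \<le> q \<longrightarrow> (\<exists>h>0. \<omega> \<notin> hit (of_rat q) (1 / real (Suc n)) h)"
    using AE_not_always_hit[of "of_rat q" "1 / real (Suc n)"] by (cases "0 \<le> q") auto
qed

lemma AE_locally_finite:
  "AE \<omega> in P. \<forall>m n::nat. emeasure (N \<omega>) ({0..real m} \<times> {1 / real (Suc n)..}) < \<infinity>"
  unfolding AE_all_countable
proof (intro allI)
  fix m n :: nat
  show "AE \<omega> in P. emeasure (N \<omega>) ({0..real m} \<times> {1 / real (Suc n)..}) < \<infinity>"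
    by (intro AE_finite_count box_in_sets) (auto simp: emeasure_box ennreal_mult_less_top)
qed

lemma AE_no_atom_at_0:
  "AE \<omega> in P. \<forall>n::nat. emeasure (N \<omega>) ({0} \<times> {1 / real (Suc n)..}) = 0"
  unfolding AE_all_countable
proof (intro allI)
  fix n :: nat
  show "AE \<omega> in P. emeasure (N \<omega>) ({0} \<times> {1 / real (Suc n)..}) = 0"
    by (intro AE_vacuum null_setsI box_in_sets) (auto simp: emeasure_box)
qed

lemma closure_zeros_AE:
  assumes "AE \<omega> in P. (\<forall>s\<ge>0. \<xi> \<omega> s \<ge> 0) \<and> N \<omega> = atom_sum \<nu> (\<xi> \<omega>)"
  shows "AE \<omega> in P. closure {t. t \<ge> 0 \<and> esn b (\<xi> \<omega>) t = 0} = uncovered b (\<xi> \<omega>)"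
  using assms AE_rational_not_always_hit AE_locally_finite AE_no_atom_at_0 AE_space
proof eventually_elim
  case (elim \<omega>)
  let ?x = "\<xi> \<omega>"
  have nonneg: "\<And>s. s \<ge> 0 \<Longrightarrow> ?x s \<ge> 0" and N: "N \<omega> = atom_sum \<nu> ?x"
    using elim(1) by auto
  have \<omega>: "\<omega> \<in> space P" by fact
  have box: "T \<times> {1 / real (Suc n)..} \<in> sets \<nu>" if "T \<in> sets borel" "T \<subseteq> {0..}" for T n
    using that by (intro box_in_sets) auto
  have fin: "finite {s. 0 \<le> s \<and> s \<le> real m \<and> 1 / real (Suc n) \<le> ?x s}" for m n
  proof (rule finite_subset)
    show "finite {s. 0 \<le> s \<and> 0 < ?x s \<and> (s, ?x s) \<in> {0..real m} \<times> {1 / real (Suc n)..}}"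
      using elim(3) box[of "{0..real m}" n] unfolding N by (subst atom_sum_finite_iff[symmetric]) auto
    have "0 < ?x s" if "1 / real (Suc n) \<le> ?x s" for s
      using that by (rule less_le_trans[rotated]) simp
    thus "{s. 0 \<le> s \<and> s \<le> real m \<and> 1 / real (Suc n) \<le> ?x s} \<subseteq>
      {s. 0 \<le> s \<and> 0 < ?x s \<and> (s, ?x s) \<in> {0..real m} \<times> {1 / real (Suc n)..}}" by auto
  qed
  show ?case
  proof (rule closure_esn_zeros[OF b_pos nonneg])
    show "?x 0 = 0"
    proof (rule ccontr)
      assume "?x 0 \<noteq> 0"
      hence pos: "?x 0 > 0" using nonneg[of 0] by simp
      then obtain n where "1 / real (Suc n) \<le> ?x 0" by (rule exists_one_over_Suc_le)
      moreover have "emeasure (atom_sum \<nu> ?x) ({0} \<times> {1 / real (Suc n)..}) = 0"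
        using elim(4) N by simp
      ultimately show False
        using pos atom_sum_eq_0_iff[OF box[of "{0}" n]] by simp
    qed
    show "countable {s. 0 \<le> s \<and> 0 < ?x s}"
    proof (rule countable_subset)
      show "{s. 0 \<le> s \<and> 0 < ?x s} \<subseteq>
        (\<Union>m. \<Union>n. {s. 0 \<le> s \<and> s \<le> real m \<and> 1 / real (Suc n) \<le> ?x s})"
      proof
        fix s assume "s \<in> {s. 0 \<le> s \<and> 0 < ?x s}"
        hence s: "0 \<le> s" "0 < ?x s" by auto
        from s(2) obtain n where "1 / real (Suc n) \<le> ?x s" by (rule exists_one_over_Suc_le)
        with s real_arch_simple[of s]
        show "s \<in> (\<Union>m. \<Union>n. {s. 0 \<le> s \<and> s \<le> real m \<and> 1 / real (Suc n) \<le> ?x s})" by blast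
      qed
      show "countable (\<Union>m. \<Union>n. {s. 0 \<le> s \<and> s \<le> real m \<and> 1 / real (Suc n) \<le> ?x s})"
        by (intro countable_UN countableI_type countable_finite fin)
    qed
    fix s p assume s: "s \<in> uncovered b ?x" "0 < ?x s" and p: "0 \<le> p" "p < s"
    show "uncovered b ?x \<inter> {p<..<s} \<noteq> {}"
    proof
      assume gap: "uncovered b ?x \<inter> {p<..<s} = {}"
      from s(2) obtain n where n: "1 / real (Suc n) \<le> ?x s" "0 < 1 / real (Suc n)" by (rule exists_one_over_Suc_le)
      obtain m where m: "s \<le> real m" using real_arch_simple by blast
      \<comment> \<open>A rational \<open>q\<close> strictly after \<open>p\<close> and after all earlier atoms of size at least \<open>1 / (n + 1)\<close>.\<close>
      define L where "L = insert p ({s. 0 \<le> s \<and> s \<le> real m \<and> 1 / real (Suc n) \<le> ?x s} \<inter> {..<s})"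
      have L: "finite L" "L \<noteq> {}" unfolding L_def by (intro finite.insertI finite_Int disjI1 fin) simp
      have "Max L < s" using L p by (auto simp: L_def)
      then obtain q where q: "Max L < of_rat q" "of_rat q < s" using of_rat_dense by blast
      have pq: "p < of_rat q" using q L by (auto simp: L_def)
      hence "0 \<le> q" using p by (metis less_eq_real_def order.trans zero_le_of_rat_iff)
      then obtain h where h: "h > 0" "\<omega> \<notin> hit (of_rat q) (1 / real (Suc n)) h"
        using elim(2) by blast
      have "?x s' < 1 / real (Suc n)" if "of_rat q < s'" "s' < s" for s'
      proof (rule ccontr)
        assume "\<not> ?x s' < 1 / real (Suc n)"
        hence "s' \<in> L" using that p pq m by (auto simp: L_def)
        hence "s' \<le> Max L" using L by simp
        thus False using that q by simp
      qed
      moreover have "uncovered b ?x \<inter> {of_rat q..<s} = {}"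
        using gap pq by fastforce
      ultimately have "\<omega> \<in> hit (of_rat q) (1 / real (Suc n)) h"
        using \<open>0 \<le> q\<close> q s n h by (intro left_isolated_atom_in_hit[OF \<omega> N]) auto
      with h show False by simp
    qed
  qed
qed

end

theorem lemma2p7:
  fixes b :: real and \<mu> :: "real measure" and P :: "'w measure"
    and N :: "'w \<Rightarrow> (real \<times> real) measure" and \<xi> :: "'w \<Rightarrow> real \<Rightarrow> real"
  assumes "b > 0"
    and "sets \<mu> = sets (restrict_space borel {0<..})"
    and "\<And>x. x > 0 \<Longrightarrow> emeasure \<mu> {x..} < \<infinity>"
    and "poisson_point_process P (esn_intensity \<mu>) N"
    and "AE \<omega> in P. (\<forall>s\<ge>0. \<xi> \<omega> s \<ge> 0) \<and> N \<omega> = atom_sum (esn_intensity \<mu>) (\<xi> \<omega>)"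
  shows "AE \<omega> in P. closure {t. t \<ge> 0 \<and> esn b (\<xi> \<omega>) t = 0} =
           {0..} - (\<Union>s\<in>{0..}. {s<..<s + \<xi> \<omega> s / b})"
proof -
  interpret esn_driver b \<mu> P N
    using assms(1-4) by (intro esn_driver.intro esn_driver_axioms.intro)
  show ?thesis
    using closure_zeros_AE[OF assms(5)] unfolding uncovered_def .
qed

end
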